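(* For a real function $f(t)$, $$L\{[u(t)f(t)]^{(-n)}\}=s^{-n}L\{f(t)\};\qquad n=0,1,\ldots,$$ where $[u(t)f(t)]^{(-n)}$ denotes the $n$-fold integral of the causal function $u(t)f(t)$. For causal functions $f(t)=f_{\rm c}(t)$ this reads $$L\{f_{\rm c}^{(-n)}(t)\}=s^{-n}L\{f_{\rm c}(t)\}.$$
   Context: The Laplace transform of a real function $f(t)$ of the real variable $t$ is $L\{f(t)\}=F(s)=\int_0^\infty f(t)e^{-st}\,dt$, with $s=\sigma+i\omega$, $\sigma>0$. It is understood as equivalent to the bilateral expression $\int_{-\infty}^{+\infty}u(t)f(t)e^{-st}\,dt$, so that $L\{f(t)\}=L\{u(t)f(t)\}$. The inverse transform is $L^{-1}\{F(s)\}=\frac{1}{2\pi i}\int_{\sigma-i\infty}^{\sigma+i\infty}F(s)e^{st}\,ds$. It satisfies $L^{-1}\{L\{f(t)\}\}=u(t)f(t)$ for $-\infty<t<+\infty$. The unit step function is $u(t)=\int_{-\infty}^t\delta(\tau)\,d\tau$. Explicitly, $u(t)=0$ for $t<0$, $u(t)=u_0(t)$ at $t=0$, and $u(t)=1$ for $t>0$. Here $u_0(t)$, the unit connect function, is a pseudo-function existing at $t=0$ and conceived of as the infinite set $\{0\ldots1\}$ of real numbers that fills the transition from $u(-0)=0$ to $u(+0)=1$. Its non-ordinary derivatives are the impulse functions, $u_0^{(n)}(t)=u^{(n)}(t)=\delta^{(n-1)}(t)$ for $n=1,2,\ldots$, with $L\{\delta^{(n)}(t)\}=s^n$ and $u(t)u^{(n)}(t)=u^{(n)}(t)$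 for $n=0,1,\ldots$. A function is causal if it is null for $t<0$ and has the form $f_{\rm c}(t)=u(t)f(t)$; impulse functions are causal, and $u(t)f_{\rm c}(t)=f_{\rm c}(t)$. The real function $f(t)$ may be any linear combination of functions that are derivable in the ordinary sense as many times as required (not necessarily causal), causal functions, and impulse functions. Non-ordinary functions are treated informally. The first integral is $[u(t)f(t)]^{(-1)}=\int_{-\infty}^tu(\tau)f(\tau)\,d\tau=u(t)\int_0^tf(\tau)\,d\tau$, which is again causal. The $n$-fold integral is obtained by iterating this operation and can be expressed as $[u(t)f(t)]^{(-n)}=\frac{u(t)}{(n-1)!}\int_0^t(t-\tau)^{n-1}f(\tau)\,d\tau$ for $n=1,2,\ldots$. For $n=0$ it is $u(t)f(t)$ itself. *)

theory Defs
  imports "HOL-Analysis.Analysis" "HOL-Computational_Algebra.Polynomial"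
begin

text \<open>
  A real function in the wide sense, \<open>f(t) + (\<Sum>k. c\<^sub>k \<delta>\<^sup>(\<^sup>k\<^sup>)(t))\<close>: an ordinary function
  \<open>f\<close> plus a linear combination of impulse functions, whose finitely many non-zero coefficients
  \<open>c\<^sub>k = coeff p k\<close> are stored in a polynomial \<open>p\<close>. Ordinary functions are those with \<open>p = 0\<close>.
\<close>
datatype gen_fun = Gen_Fun (ordinary_part: "real \<Rightarrow> real") (impulse_coeffs: "real poly")

text \<open>
  The value \<open>u0\<close> at the origin is a parameter: it stands for an arbitrary member of the set of
  reals between 0 and 1 which the unit connect function fills in at \<open>t = 0\<close>.
\<close>
definition unit_step :: "real \<Rightarrow> real \<Rightarrow> real" where
  "unit_step u0 t = (if t < 0 then 0 else if t = 0 then u0 else 1)"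

text \<open>Impulse functions are unchanged because \<open>u(t) \<delta>\<^sup>(\<^sup>k\<^sup>)(t) = \<delta>\<^sup>(\<^sup>k\<^sup>)(t)\<close>.\<close>
definition step_times :: "real \<Rightarrow> gen_fun \<Rightarrow> gen_fun" where
  "step_times u0 f = Gen_Fun (\<lambda>t. unit_step u0 t * ordinary_part f t) (impulse_coeffs f)"

definition causal :: "real \<Rightarrow> gen_fun \<Rightarrow> bool" where
  "causal u0 f \<longleftrightarrow> (\<forall>t<0. ordinary_part f t = 0) \<and> (\<exists>g. f = step_times u0 g)"

text \<open>
  The integral from \<open>-\<infinity>\<close> to \<open>t\<close>. On impulse functions it is \<open>\<delta>\<^sup>(\<^sup>k\<^sup>+\<^sup>1\<^sup>) \<mapsto> \<delta>\<^sup>(\<^sup>k\<^sup>)\<close>, which shifts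
  the coefficients, and \<open>\<delta> \<mapsto> u\<close>, which feeds the coefficient of \<open>\<delta>\<close> into the ordinary part.
\<close>
definition first_integral :: "real \<Rightarrow> gen_fun \<Rightarrow> gen_fun" where
  "first_integral u0 f =
     Gen_Fun (\<lambda>t. integral {..t} (ordinary_part f) + coeff (impulse_coeffs f) 0 * unit_step u0 t)
             (poly_shift 1 (impulse_coeffs f))"

definition nfold_integral :: "real \<Rightarrow> nat \<Rightarrow> gen_fun \<Rightarrow> gen_fun" where
  "nfold_integral u0 n = first_integral u0 ^^ n"

text \<open>
  The Henstock-Kurzweil integral over \<open>[0,\<infinity>)\<close> agrees with the Lebesgue integral where the latter
  exists, and also covers conditionally convergent improper integrals.
\<close>
definition laplace_converges :: "gen_fun \<Rightarrow> complex \<Rightarrow> bool" where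
  "laplace_converges f s \<longleftrightarrow>
     (\<lambda>t. complex_of_real (ordinary_part f t) * exp (- s * complex_of_real t)) integrable_on {0..}"

text \<open>The impulse functions contribute according to \<open>L{\<delta>\<^sup>(\<^sup>k\<^sup>)(t)} = s\<^sup>k\<close>.\<close>
definition laplace :: "gen_fun \<Rightarrow> complex \<Rightarrow> complex" where
  "laplace f s =
     integral {0..} (\<lambda>t. complex_of_real (ordinary_part f t) * exp (- s * complex_of_real t))
     + (\<Sum>k\<le>degree (impulse_coeffs f). complex_of_real (coeff (impulse_coeffs f) k) * s ^ k)"

end

theory Submission
  imports Defs
begin

text \<open>
  Integration multiplies the Laplace transform by \<open>1 / s\<close>, so everything reduces to one integration
  (\<open>laplace_first_integral\<close>); the \<open>n\<close>-fold statement is an induction, in which vanishing on the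
  negative axis and convergence at \<open>s\<close> are passed on from step to step. On the impulses the
  claim is algebra: \<open>c\<^sub>0 + c\<^sub>1 s + \<dots>\<close> divided by \<open>s\<close> is \<open>c\<^sub>0 / s\<close>, the transform of
  \<open>c\<^sub>0 u(t)\<close>, plus the value at \<open>s\<close> of the shifted polynomial.

  The analysis is in the ordinary part \<open>g\<close> (\<open>laplace_primitive\<close>). Put
  \<open>G(t) = \<integral>\<^sub>0\<^sup>t g\<close>, \<open>\<Phi>(b) = \<integral>\<^sub>0\<^sup>b g(t) e\<^sup>-\<^sup>s\<^sup>t dt\<close> and
  \<open>H(b) = \<integral>\<^sub>0\<^sup>b G(t) e\<^sup>-\<^sup>s\<^sup>t dt\<close>. Integration by parts gives
  \<open>G(b) e\<^sup>-\<^sup>s\<^sup>b = \<Phi>(b) - s H(b)\<close>. The boundary term on the left does not obviously vanish in the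
  limit, because the convergence of \<open>\<Phi>\<close> may be merely conditional. But the left-hand side is also
  \<open>H'(b)\<close>, so \<open>H\<close> solves the linear equation \<open>H' + s H = \<Phi>\<close>, whose homogeneous solutions decay
  since \<open>Re s > 0\<close>; hence \<open>H\<close> tends to \<open>L / s\<close> when \<open>\<Phi>\<close> tends to \<open>L\<close>
  (\<open>linear_ode_limit\<close>).

  Since \<open>g\<close> is only Henstock-Kurzweil integrable, neither the integration by parts nor the local
  integrability of \<open>g = e\<^sup>s\<^sup>t (g e\<^sup>-\<^sup>s\<^sup>t)\<close> can be had by absolute convergence. Both come from the
  second mean value theorem for monotone factors (\<open>by_parts_mono\<close>), extended by linearity to
  continuously differentiable ones.
\<close>

section \<open>Integration by parts for Henstock-Kurzweil integrable functions\<close>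

text \<open>
  Write \<open>F\<close> for the indefinite integral of \<open>f\<close>. As \<open>F\<close> need not be differentiable outside a
  countable set, the fundamental theorem cannot be applied to \<open>g F\<close>. It can be applied to
  \<open>D(x) = g(x) F(x) - \<integral>\<^sub>a\<^sup>x g f\<close>: the second mean value theorem on \<open>[x, y]\<close> says that
  \<open>D(y) - D(x) = F(c) (g(y) - g(x))\<close> for some \<open>c\<close> in between, and continuity of \<open>F\<close> then makes
  \<open>D\<close> differentiable everywhere, with derivative \<open>g' F\<close>.
\<close>
lemma by_parts_mono:
  fixes f g g' :: "real \<Rightarrow> real"
  assumes f: "f integrable_on {a..b}" and "a \<le> b"
    and mono: "\<And>x y. \<lbrakk>a \<le> x; x \<le> y; y \<le> b\<rbrakk> \<Longrightarrow> g x \<le> g y"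
    and g': "\<And>x. x \<in> {a..b} \<Longrightarrow> (g has_real_derivative g' x) (at x within {a..b})"
  shows "(\<lambda>x. g x * f x) integrable_on {a..b}"
    and "((\<lambda>x. g' x * integral {a..x} f) has_integral
           g b * integral {a..b} f - integral {a..b} (\<lambda>x. g x * f x)) {a..b}"
proof -
  show gf: "(\<lambda>x. g x * f x) integrable_on {a..b}"
    by (rule second_mean_value_theorem_full [OF f \<open>a \<le> b\<close> mono]) (auto simp: integrable_on_def)
  define F where "F = (\<lambda>x. integral {a..x} f)"
  have F_cont: "continuous_on {a..b} F"
    unfolding F_def by (rule indefinite_integral_continuous_1 [OF f])
  define D where "D = (\<lambda>x. g x * F x - integral {a..x} (\<lambda>x. g x * f x))"
  have incr: "\<exists>c\<in>{x..y}. D y - D x = F c * (g y - g x)" if "a \<le> x" "x \<le> y" "y \<le> b" for x y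
  proof -
    have "f integrable_on {x..y}"
      using integrable_subinterval_real [OF f] that by auto
    moreover have "g u \<le> g v" if "x \<le> u" "u \<le> v" "v \<le> y" for u v
      using mono that \<open>a \<le> x\<close> \<open>y \<le> b\<close> by simp
    ultimately obtain c where c: "c \<in> {x..y}"
      and I: "((\<lambda>t. g t * f t) has_integral (g x * integral {x..c} f + g y * integral {c..y} f)) {x..y}"
      by (rule second_mean_value_theorem_full [OF _ \<open>x \<le> y\<close>])
    have piece: "integral {u..v} f = F v - F u" if "a \<le> u" "u \<le> v" "v \<le> b" for u v
    proof -
      have "f integrable_on {a..v}"
        using integrable_subinterval_real [OF f] that by auto
      from Henstock_Kurzweil_Integration.integral_combine [OF that(1,2) this] show ?thesis
        by (simp add: F_def)
    qed
    have "(\<lambda>t. g t * f t) integrable_on {a..y}"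
      using integrable_subinterval_real [OF gf] that by auto
    from Henstock_Kurzweil_Integration.integral_combine [OF that(1,2) this]
    have "integral {a..y} (\<lambda>t. g t * f t) - integral {a..x} (\<lambda>t. g t * f t)
          = g x * (F c - F x) + g y * (F y - F c)"
      using integral_unique [OF I] c that by (simp add: piece)
    then have "D y - D x = F c * (g y - g x)"
      by (simp add: D_def algebra_simps)
    with c show ?thesis by blast
  qed
  have "(D has_real_derivative g' x * F x) (at x within {a..b})" if x: "x \<in> {a..b}" for x
  proof -
    have "\<exists>c. c \<in> {a..b} \<and> \<bar>c - x\<bar> \<le> \<bar>y - x\<bar> \<and> D y - D x = F c * (g y - g x)" if y: "y \<in> {a..b}" for y
    proof (cases "x \<le> y")
      case True
      then obtain c where "c \<in> {x..y}" "D y - D x = F c * (g y - g x)"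
        using incr [of x y] x y by auto
      then show ?thesis using x y by (intro exI [of _ c]) auto
    next
      case False
      then obtain c where "c \<in> {y..x}" "D x - D y = F c * (g x - g y)"
        using incr [of y x] x y by auto
      moreover from this have "D y - D x = F c * (g y - g x)"
        by (simp add: right_diff_distrib)
      ultimately show ?thesis using x y False by (intro exI [of _ c]) auto
    qed
    then obtain c where c: "\<And>y. y \<in> {a..b} \<Longrightarrow> c y \<in> {a..b}"
        "\<And>y. y \<in> {a..b} \<Longrightarrow> \<bar>c y - x\<bar> \<le> \<bar>y - x\<bar>"
        "\<And>y. y \<in> {a..b} \<Longrightarrow> D y - D x = F (c y) * (g y - g x)"
      using bchoice [of "{a..b}"
          "\<lambda>y c. c \<in> {a..b} \<and> \<bar>c - x\<bar> \<le> \<bar>y - x\<bar> \<and> D y - D x = F c * (g y - g x)"] by blast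
    have in_ab: "\<forall>\<^sub>F y in at x within {a..b}. y \<in> {a..b}"
      by (simp add: eventually_at_filter)
    have "((\<lambda>y. \<bar>y - x\<bar>) \<longlongrightarrow> 0) (at x within {a..b})"
      by (intro tendsto_rabs_zero LIM_zero tendsto_ident_at)
    then have "((\<lambda>y. c y - x) \<longlongrightarrow> 0) (at x within {a..b})"
      by (rule Lim_null_comparison [rotated]) (rule eventually_mono [OF in_ab], simp add: c(2))
    then have "(c \<longlongrightarrow> x) (at x within {a..b})"
      by (simp add: LIM_zero_iff)
    then have "((\<lambda>y. F (c y)) \<longlongrightarrow> F x) (at x within {a..b})"
      by (rule continuous_on_tendsto_compose [OF F_cont _ x eventually_mono [OF in_ab c(1)]])
    moreover have "((\<lambda>y. (g y - g x) / (y - x)) \<longlongrightarrow> g' x) (at x within {a..b})"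
      using g' [OF x] by (simp add: has_field_derivative_iff)
    ultimately have "((\<lambda>y. (g y - g x) / (y - x) * F (c y)) \<longlongrightarrow> g' x * F x) (at x within {a..b})"
      by (intro tendsto_mult)
    then show ?thesis
      unfolding has_field_derivative_iff
      by (rule Lim_transform_eventually)
        (rule eventually_mono [OF in_ab], simp add: c(3) mult.commute)
  qed
  then have "((\<lambda>x. g' x * F x) has_integral D b - D a) {a..b}"
    by (intro fundamental_theorem_of_calculus \<open>a \<le> b\<close>)
      (simp add: has_real_derivative_iff_has_vector_derivative)
  then show "((\<lambda>x. g' x * integral {a..x} f) has_integral
           g b * integral {a..b} f - integral {a..b} (\<lambda>x. g x * f x)) {a..b}"
    by (simp add: D_def F_def)
qed

text \<open>
  A lower bound \<open>-K\<close> on \<open>h'\<close> makes \<open>h\<close> the difference of the monotone functions \<open>h(x) + K x\<close> and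
  \<open>K x\<close>, and the claim is linear in the factor.
\<close>
lemma by_parts_C1:
  fixes f h h' :: "real \<Rightarrow> real"
  assumes f: "f integrable_on {a..b}" and "a \<le> b"
    and h': "\<And>x. x \<in> {a..b} \<Longrightarrow> (h has_real_derivative h' x) (at x within {a..b})"
    and cont: "continuous_on {a..b} h'"
  shows "(\<lambda>x. h x * f x) integrable_on {a..b}"
    and "((\<lambda>x. h' x * integral {a..x} f) has_integral
           h b * integral {a..b} f - integral {a..b} (\<lambda>x. h x * f x)) {a..b}"
proof -
  have "compact (h' ` {a..b})"
    using cont by (intro compact_continuous_image) auto
  then obtain K where K: "K > 0" "\<And>x. x \<in> {a..b} \<Longrightarrow> \<bar>h' x\<bar> \<le> K"
    by (auto dest!: compact_imp_bounded simp: bounded_pos)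
  define g where "g = (\<lambda>x. h x + K * x)"
  have gder: "(g has_real_derivative h' x + K) (at x within {a..b})" if "x \<in> {a..b}" for x
    unfolding g_def using h' [OF that] by (auto intro!: derivative_eq_intros)
  have gmono: "g x \<le> g y" if "a \<le> x" "x \<le> y" "y \<le> b" for x y
  proof (rule DERIV_nonneg_imp_increasing_open [OF \<open>x \<le> y\<close>])
    fix t assume t: "x < t" "t < y"
    have "(g has_real_derivative h' t + K) (at t)"
      using gder [of t] t that by (simp add: at_within_Icc_at)
    moreover have "0 \<le> h' t + K"
      using K(2) [of t] t that by auto
    ultimately show "\<exists>y. (g has_real_derivative y) (at t) \<and> 0 \<le> y" by blast
  next
    have "continuous_on {a..b} g"
      using gder by (intro DERIV_continuous_on)
    then show "continuous_on {x..y} g"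
      using that by (auto elim: continuous_on_subset)
  qed
  note G = by_parts_mono [of f a b g "\<lambda>x. h' x + K", OF f \<open>a \<le> b\<close> gmono gder]
  have lin_mono: "K * x \<le> K * y" if "x \<le> y" for x y
    using K(1) that by simp
  have lin_der: "((\<lambda>x. K * x) has_real_derivative K) (at x within {a..b})" for x
    by (auto intro!: derivative_eq_intros)
  note L = by_parts_mono [of f a b "\<lambda>x. K * x" "\<lambda>x. K", OF f \<open>a \<le> b\<close> lin_mono lin_der]
  have eq: "(\<lambda>x. g x * f x - K * x * f x) = (\<lambda>x. h x * f x)"
    by (simp add: g_def fun_eq_iff algebra_simps)
  show "(\<lambda>x. h x * f x) integrable_on {a..b}"
    using integrable_diff [OF G(1) L(1)] by (simp add: eq)
  have "integral {a..b} (\<lambda>x. h x * f x)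
        = integral {a..b} (\<lambda>x. g x * f x) - integral {a..b} (\<lambda>x. K * x * f x)"
    using integral_diff [OF G(1) L(1)] by (simp add: eq)
  then have "(g b * integral {a..b} f - integral {a..b} (\<lambda>x. g x * f x))
        - (K * b * integral {a..b} f - integral {a..b} (\<lambda>x. K * x * f x))
      = h b * integral {a..b} f - integral {a..b} (\<lambda>x. h x * f x)"
    by (simp only: g_def distrib_right)
  moreover have "(h' x + K) * I - K * I = h' x * I" for x I
    by (simp add: distrib_right)
  ultimately show "((\<lambda>x. h' x * integral {a..x} f) has_integral
           h b * integral {a..b} f - integral {a..b} (\<lambda>x. h x * f x)) {a..b}"
    using has_integral_diff [OF G(2) L(2)] by simp
qed

lemma by_parts_complex_kernel:
  fixes f :: "real \<Rightarrow> real" and h h' :: "real \<Rightarrow> complex"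
  assumes f: "f integrable_on {a..b}" and "a \<le> b"
    and h': "\<And>x. x \<in> {a..b} \<Longrightarrow> (h has_vector_derivative h' x) (at x within {a..b})"
    and cont: "continuous_on {a..b} h'"
  shows "(\<lambda>x. h x * of_real (f x)) integrable_on {a..b}"
    and "((\<lambda>x. h' x * of_real (integral {a..x} f)) has_integral
           h b * of_real (integral {a..b} f) - integral {a..b} (\<lambda>x. h x * of_real (f x))) {a..b}"
proof -
  have der: "((\<lambda>x. p (h x)) has_real_derivative p (h' x)) (at x within {a..b})"
    if "bounded_linear p" "x \<in> {a..b}" for p :: "complex \<Rightarrow> real" and x
    using bounded_linear.has_vector_derivative [OF that(1) h' [OF that(2)]]
    by (simp add: has_real_derivative_iff_has_vector_derivative)
  note R = by_parts_C1 [OF f \<open>a \<le> b\<close> der [OF bounded_linear_Re] continuous_on_Re [OF cont]]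
  note I = by_parts_C1 [OF f \<open>a \<le> b\<close> der [OF bounded_linear_Im] continuous_on_Im [OF cont]]
  have split: "complex_of_real (Re z * y) + \<i> * of_real (Im z * y) = z * of_real y" for z y
    by (simp add: complex_eq_iff)
  define IR where "IR = integral {a..b} (\<lambda>x. Re (h x) * f x)"
  define II where "II = integral {a..b} (\<lambda>x. Im (h x) * f x)"
  have "((\<lambda>x. of_real (Re (h x) * f x) + \<i> * of_real (Im (h x) * f x)) has_integral
          of_real IR + \<i> * of_real II) {a..b}"
    unfolding IR_def II_def
    by (intro has_integral_add has_integral_mult_right has_integral_of_real
        integrable_integral R(1) I(1))
  then have hf: "((\<lambda>x. h x * of_real (f x)) has_integral of_real IR + \<i> * of_real II) {a..b}"
    by (simp only: split)
  then show "(\<lambda>x. h x * of_real (f x)) integrable_on {a..b}" by blast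
  have "((\<lambda>x. of_real (Re (h' x) * integral {a..x} f) + \<i> * of_real (Im (h' x) * integral {a..x} f))
          has_integral of_real (Re (h b) * integral {a..b} f - IR)
                     + \<i> * of_real (Im (h b) * integral {a..b} f - II)) {a..b}"
    unfolding IR_def II_def
    by (intro has_integral_add has_integral_mult_right has_integral_of_real R(2) I(2))
  then have "((\<lambda>x. h' x * of_real (integral {a..x} f)) has_integral
               of_real (Re (h b) * integral {a..b} f - IR)
                     + \<i> * of_real (Im (h b) * integral {a..b} f - II)) {a..b}"
    by (simp only: split)
  moreover have "of_real (Re (h b) * integral {a..b} f - IR)
                     + \<i> * of_real (Im (h b) * integral {a..b} f - II)
      = h b * of_real (integral {a..b} f) - integral {a..b} (\<lambda>x. h x * of_real (f x))"
    by (simp add: integral_unique [OF hf] complex_eq_iff)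
  ultimately show "((\<lambda>x. h' x * of_real (integral {a..x} f)) has_integral
           h b * of_real (integral {a..b} f) - integral {a..b} (\<lambda>x. h x * of_real (f x))) {a..b}"
    by simp
qed

text \<open>
  This form is what recovers the integrability of a function from that of its product with an
  exponential.
\<close>
lemma integrable_C1_mult:
  fixes f h h' :: "real \<Rightarrow> complex"
  assumes f: "f integrable_on {a..b}" and "a \<le> b"
    and h': "\<And>x. x \<in> {a..b} \<Longrightarrow> (h has_vector_derivative h' x) (at x within {a..b})"
    and cont: "continuous_on {a..b} h'"
  shows "(\<lambda>x. h x * f x) integrable_on {a..b}"
proof -
  have "(\<lambda>x. Re (f x)) integrable_on {a..b}" "(\<lambda>x. Im (f x)) integrable_on {a..b}"
    using integrable_linear [OF f bounded_linear_Re] integrable_linear [OF f bounded_linear_Im]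
    by (simp_all add: o_def)
  then have "(\<lambda>x. h x * of_real (Re (f x)) + \<i> * (h x * of_real (Im (f x)))) integrable_on {a..b}"
    by (intro integrable_add integrable_on_mult_right
        by_parts_complex_kernel(1) [OF _ \<open>a \<le> b\<close> h' cont])
  moreover have "h x * of_real (Re (f x)) + \<i> * (h x * of_real (Im (f x))) = h x * f x" for x
    by (subst (3) complex_eq) (simp add: algebra_simps)
  ultimately show ?thesis by simp
qed

section \<open>Improper integrals and a linear differential equation\<close>

text \<open>
  Hake's theorem for a half-line. The gauge integral over an unbounded set is the limit over large
  boxes \<open>[u, b]\<close> of the integrals of the function cut off outside the set, and such a box meets
  the half-line in \<open>[a, b]\<close>. This holds for conditionally convergent integrals as well.
\<close>
lemma has_integral_Ici_iff:
  fixes f :: "real \<Rightarrow> 'a::banach"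
  shows "(f has_integral L) {a..} \<longleftrightarrow>
    (\<forall>b\<ge>a. f integrable_on {a..b}) \<and> ((\<lambda>b. integral {a..b} f) \<longlongrightarrow> L) at_top"
proof -
  define fa where "fa = (\<lambda>x. if x \<in> {a..} then f x else 0)"
  have cut: "{a..} \<inter> {u..b} = {max a u..b}" for u b :: real by auto
  have fa_integrable: "fa integrable_on {u..b} \<longleftrightarrow> f integrable_on {max a u..b}" for u b
    unfolding fa_def integrable_on_def has_integral_restrict_Int cut ..
  have fa_integral: "integral {u..b} fa = integral {max a u..b} f" for u b
    unfolding fa_def integral_restrict_Int cut ..
  have max_a: "max a u = a" if "u \<le> a" for u using that by simp
  have "(\<forall>u b. fa integrable_on cbox u b) \<longleftrightarrow> (\<forall>b\<ge>a. f integrable_on {a..b})"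
  proof
    assume *: "\<forall>u b. fa integrable_on cbox u b"
    show "\<forall>b\<ge>a. f integrable_on {a..b}"
    proof (intro allI impI)
      fix b
      from * have "fa integrable_on {a..b}" by (metis cbox_interval)
      then show "f integrable_on {a..b}" by (simp add: fa_integrable)
    qed
  next
    assume *: "\<forall>b\<ge>a. f integrable_on {a..b}"
    have "f integrable_on {max a u..b}" for u b
    proof (cases "a \<le> b")
      case True
      with * have "f integrable_on {a..b}" by blast
      then show ?thesis by (rule integrable_subinterval_real) auto
    qed auto
    then show "\<forall>u b. fa integrable_on cbox u b" by (simp add: fa_integrable)
  qed
  moreover have "(\<forall>e>0. \<exists>B>0. \<forall>u b. ball 0 B \<subseteq> cbox u b \<longrightarrow> norm (integral (cbox u b) fa - L) < e)
      \<longleftrightarrow> ((\<lambda>b. integral {a..b} f) \<longlongrightarrow> L) at_top" (is "?lhs \<longleftrightarrow> ?rhs")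
  proof
    assume ?lhs
    show ?rhs
    proof (rule tendstoI)
      fix e :: real assume "e > 0"
      with \<open>?lhs\<close> obtain B where B: "\<And>u b. ball 0 B \<subseteq> {u..b} \<Longrightarrow> norm (integral {u..b} fa - L) < e"
        by (metis cbox_interval)
      have "dist (integral {a..b} f) L < e" if "b \<ge> max B \<bar>a\<bar>" for b
        using B [of "- b" b] that by (force simp: fa_integral max_a dist_norm)
      then show "\<forall>\<^sub>F b in at_top. dist (integral {a..b} f) L < e"
        unfolding eventually_at_top_linorder by blast
    qed
  next
    assume ?rhs
    show ?lhs
    proof (intro allI impI)
      fix e :: real assume "e > 0"
      with \<open>?rhs\<close> obtain T where T: "\<And>b. b \<ge> T \<Longrightarrow> norm (integral {a..b} f - L) < e"
        unfolding tendsto_iff eventually_at_top_linorder dist_norm by blast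
      define B where "B = \<bar>T\<bar> + \<bar>a\<bar> + 1"
      have "norm (integral {u..b} fa - L) < e" if sub: "ball 0 (2 * B) \<subseteq> {u..b}" for u b
      proof -
        \<comment> \<open>Doubling the radius puts \<open>-B\<close> and \<open>B\<close> into the open ball.\<close>
        have "- B \<in> ball 0 (2 * B)" "B \<in> ball 0 (2 * B)" by (auto simp: B_def)
        then have "- B \<in> {u..b}" "B \<in> {u..b}" using sub by blast+
        then have "u \<le> - B" "B \<le> b" by auto
        then have "u \<le> a" "T \<le> b" by (auto simp: B_def)
        then show ?thesis by (simp add: fa_integral max_a T)
      qed
      moreover have "2 * B > 0" by (auto simp: B_def)
      ultimately show "\<exists>B>0. \<forall>u b. ball 0 B \<subseteq> cbox u b \<longrightarrow> norm (integral (cbox u b) fa - L) < e"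
        by (metis cbox_interval)
    qed
  qed
  ultimately show ?thesis
    by (subst has_integral_alt') (simp add: fa_def)
qed

lemma exp_kernel_deriv:
  "((\<lambda>t. exp (z * complex_of_real t)) has_vector_derivative z * exp (z * of_real t)) (at t within S)"
  by (auto intro!: derivative_eq_intros has_vector_derivative_real_field)

text \<open>
  With the integrating factor, \<open>M(t) = (H(t) - L / s) e\<^sup>s\<^sup>t\<close> satisfies
  \<open>M' = (\<Phi> - L) e\<^sup>s\<^sup>t\<close>. From the point \<open>A\<close> on where \<open>\<Phi>\<close> is within \<open>d\<close> of \<open>L\<close>, the norm of
  \<open>M'\<close> is at most the derivative of \<open>(d / \<sigma>) e\<^sup>\<sigma>\<^sup>t\<close> with \<open>\<sigma> = Re s\<close>. Integrating and dividing by
  \<open>e\<^sup>\<sigma>\<^sup>t\<close> bounds the distance of \<open>H\<close> from \<open>L / s\<close> by \<open>d / \<sigma>\<close> plus an exponentially decaying term.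
\<close>
lemma linear_ode_limit:
  fixes H \<Phi> :: "real \<Rightarrow> complex"
  assumes s: "Re s > 0"
    and H: "\<And>t. t > a \<Longrightarrow> (H has_vector_derivative \<Phi> t - s * H t) (at t)"
    and \<Phi>: "(\<Phi> \<longlongrightarrow> L) at_top"
  shows "(H \<longlongrightarrow> L / s) at_top"
proof -
  define \<sigma> where "\<sigma> = Re s"
  have \<sigma>: "\<sigma> > 0" and s0: "s \<noteq> 0" using s by (auto simp: \<sigma>_def)
  define M where "M = (\<lambda>t. (H t - L / s) * exp (s * of_real t))"
  have norm_exp: "norm (exp (s * of_real t)) = exp (\<sigma> * t)" for t
    by (simp add: \<sigma>_def)
  have M: "(M has_vector_derivative (\<Phi> t - L) * exp (s * of_real t)) (at t)" if "t > a" for t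
  proof -
    have "(M has_vector_derivative
        (H t - L / s) * (s * exp (s * of_real t)) + (\<Phi> t - s * H t - 0) * exp (s * of_real t)) (at t)"
      unfolding M_def
      by (intro has_vector_derivative_mult has_vector_derivative_diff has_vector_derivative_const H that
          exp_kernel_deriv)
    then show ?thesis
      using s0 by (simp add: algebra_simps)
  qed
  show ?thesis
  proof (rule tendstoI)
    fix e :: real assume e: "e > 0"
    define d where "d = e * \<sigma> / 2"
    have "d > 0" using e \<sigma> by (simp add: d_def)
    then have "\<forall>\<^sub>F t in at_top. dist (\<Phi> t) L < d"
      using \<Phi> by (simp add: tendsto_iff)
    then obtain A0 where A0: "\<And>t. t \<ge> A0 \<Longrightarrow> dist (\<Phi> t) L < d"
      by (auto simp: eventually_at_top_linorder)
    define A where "A = max A0 (a + 1)"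
    have bound: "norm (H T - L / s) \<le> norm (M A) * exp (- (\<sigma> * T)) + e / 2" if "T > A" for T
    proof -
      have "continuous_on {A..T} M"
        by (intro continuous_at_imp_continuous_on ballI has_vector_derivative_continuous [OF M])
          (auto simp: A_def)
      moreover have "continuous_on {A..T} (\<lambda>t. d / \<sigma> * exp (\<sigma> * t))"
        by (intro continuous_intros)
      moreover have "((\<lambda>t. d / \<sigma> * exp (\<sigma> * t)) has_vector_derivative d * exp (\<sigma> * t)) (at t)" for t
        using \<sigma> by (auto intro!: derivative_eq_intros
            simp flip: has_real_derivative_iff_has_vector_derivative)
      moreover have "norm ((\<Phi> t - L) * exp (s * of_real t)) \<le> d * exp (\<sigma> * t)" if "A < t" for t
        using A0 [of t] that
        unfolding norm_mult norm_exp by (intro mult_right_mono) (auto simp: A_def dist_norm)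
      ultimately have "norm (M T - M A) \<le> d / \<sigma> * exp (\<sigma> * T) - d / \<sigma> * exp (\<sigma> * A)"
        using that M by (intro differentiable_bound_general
            [where f' = "\<lambda>t. (\<Phi> t - L) * exp (s * of_real t)" and \<phi>' = "\<lambda>t. d * exp (\<sigma> * t)"])
          (auto simp: A_def)
      also have "\<dots> \<le> e / 2 * exp (\<sigma> * T)"
        using \<sigma> e by (simp add: d_def)
      finally have "norm (M T) \<le> norm (M A) + e / 2 * exp (\<sigma> * T)"
        using norm_triangle_sub [of "M T" "M A"] by linarith
      then have "norm (M T) * exp (- (\<sigma> * T)) \<le> (norm (M A) + e / 2 * exp (\<sigma> * T)) * exp (- (\<sigma> * T))"
        by (rule mult_right_mono) simp
      moreover have MT: "norm (M T) = norm (H T - L / s) * exp (\<sigma> * T)"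
        by (simp only: M_def norm_mult norm_exp)
      moreover have "exp (\<sigma> * T) * exp (- (\<sigma> * T)) = 1"
        by (simp flip: exp_add)
      ultimately show ?thesis
        using MT by (simp add: distrib_right mult.assoc)
    qed
    have "((\<lambda>T. norm (M A) * exp (- (\<sigma> * T))) \<longlongrightarrow> 0) at_top"
      by (intro tendsto_mult_right_zero filterlim_compose [OF exp_at_bot]
          filterlim_compose [OF filterlim_uminus_at_bot_at_top]
          filterlim_tendsto_pos_mult_at_top [OF tendsto_const \<sigma> filterlim_ident])
    then have "\<forall>\<^sub>F T in at_top. norm (M A) * exp (- (\<sigma> * T)) < e / 2"
      using e by (intro order_tendstoD) auto
    then show "\<forall>\<^sub>F T in at_top. dist (H T) (L / s) < e"
      using eventually_gt_at_top [of A]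
      by eventually_elim (use bound in \<open>fastforce simp: dist_norm\<close>)
  qed
qed

section \<open>The Laplace transform of a primitive\<close>

text \<open>
  The convergence and the value of the transform of the primitive come out together, from the
  differential equation \<open>H' = \<Phi> - s H\<close> for the truncated transforms. That the primitive grows more
  slowly than \<open>e\<^sup>s\<^sup>t\<close> is then a consequence.
\<close>
lemma laplace_primitive:
  fixes g :: "real \<Rightarrow> real" and s L :: complex
  assumes s: "Re s > 0"
    and g: "((\<lambda>t. of_real (g t) * exp (- s * of_real t)) has_integral L) {0..}"
  shows "((\<lambda>t. of_real (integral {0..t} g) * exp (- s * of_real t)) has_integral L / s) {0..}"
proof -
  have s0: "s \<noteq> 0" using s by auto
  define k where "k = (\<lambda>t. of_real (g t) * exp (- s * complex_of_real t))"
  define \<Phi> where "\<Phi> = (\<lambda>b. integral {0..b} k)"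
  have k: "k integrable_on {0..b}" if "b \<ge> 0" for b
    using g that unfolding k_def has_integral_Ici_iff by blast
  have \<Phi>: "(\<Phi> \<longlongrightarrow> L) at_top"
    using g unfolding \<Phi>_def k_def has_integral_Ici_iff by blast
  have g_int: "g integrable_on {0..b}" for b
  proof (cases "b \<ge> 0")
    case True
    have "(\<lambda>t. exp (s * complex_of_real t) * k t) integrable_on {0..b}"
      by (rule integrable_C1_mult [OF k [OF True] True exp_kernel_deriv]) (intro continuous_intros)
    moreover have "exp (s * complex_of_real t) * k t = of_real (g t)" for t
      by (simp add: k_def exp_minus)
    ultimately have "(\<lambda>t. complex_of_real (g t)) integrable_on {0..b}"
      by simp
    from integrable_linear [OF this bounded_linear_Re] show ?thesis
      by (simp add: o_def)
  qed auto
  define G where "G = (\<lambda>t. integral {0..t} g)"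
  define q where "q = (\<lambda>t. of_real (G t) * exp (- s * complex_of_real t))"
  define H where "H = (\<lambda>b. integral {0..b} q)"
  have parts: "q b = \<Phi> b - s * H b" if "b \<ge> 0" for b
  proof -
    have "((\<lambda>t. - s * exp (- s * of_real t) * of_real (integral {0..t} g)) has_integral
        exp (- s * of_real b) * of_real (integral {0..b} g)
        - integral {0..b} (\<lambda>t. exp (- s * of_real t) * of_real (g t))) {0..b}"
      by (rule by_parts_complex_kernel(2) [OF g_int that exp_kernel_deriv]) (intro continuous_intros)
    then have "((\<lambda>t. - s * q t) has_integral q b - \<Phi> b) {0..b}"
      by (simp add: q_def G_def \<Phi>_def k_def mult_ac)
    then have "integral {0..b} (\<lambda>t. - s * q t) = q b - \<Phi> b"
      by (rule integral_unique)
    then have "- s * H b = q b - \<Phi> b"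
      by (simp add: H_def)
    then show ?thesis by (simp add: algebra_simps)
  qed
  have q_cont: "continuous_on {0..b} q" for b
    unfolding q_def G_def by (intro continuous_intros indefinite_integral_continuous_1 g_int)
  have "(H has_vector_derivative \<Phi> t - s * H t) (at t)" if "t > 0" for t
  proof -
    have "(H has_vector_derivative q t) (at t within {0..t + 1})"
      unfolding H_def using that by (intro integral_has_vector_derivative q_cont) auto
    then show ?thesis
      using that parts [of t] by (simp add: at_within_Icc_at)
  qed
  then have "(H \<longlongrightarrow> L / s) at_top"
    by (rule linear_ode_limit [OF s _ \<Phi>])
  then have "(q has_integral L / s) {0..}"
    unfolding has_integral_Ici_iff H_def by (auto intro: integrable_continuous_real q_cont)
  then show "((\<lambda>t. of_real (integral {0..t} g) * exp (- s * of_real t)) has_integral L / s) {0..}"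
    by (simp only: q_def G_def)
qed

lemma laplace_unit_step:
  assumes "Re s > 0"
  shows "((\<lambda>t. complex_of_real (unit_step u0 t) * exp (- s * of_real t)) has_integral 1 / s) {0..}"
proof -
  have s0: "s \<noteq> 0" using assms by auto
  have int: "((\<lambda>t. exp (- s * complex_of_real t)) has_integral (1 - exp (- s * of_real b)) / s) {0..b}"
    if "b \<ge> 0" for b
  proof -
    have "((\<lambda>t. - exp (- s * of_real t) / s) has_vector_derivative exp (- s * of_real t)) (at t within {0..b})" for t
      using s0 has_vector_derivative_divide [OF exp_kernel_deriv, of "- s" "- s" t "{0..b}"] by simp
    from fundamental_theorem_of_calculus [OF that this] show ?thesis
      using s0 by (simp add: diff_divide_distrib)
  qed
  have "((\<lambda>b. exp (- (Re s * b))) \<longlongrightarrow> 0) at_top"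
    by (intro filterlim_compose [OF exp_at_bot]
          filterlim_compose [OF filterlim_uminus_at_bot_at_top]
          filterlim_tendsto_pos_mult_at_top [OF tendsto_const assms filterlim_ident])
  then have "((\<lambda>b. exp (- s * complex_of_real b)) \<longlongrightarrow> 0) at_top"
    by (intro tendsto_norm_zero_cancel [where f = "\<lambda>b. exp (- s * complex_of_real b)"]) simp
  then have "((\<lambda>b. (1 - exp (- s * complex_of_real b)) / s) \<longlongrightarrow> (1 - 0) / s) at_top"
    by (intro tendsto_intros s0)
  moreover have "\<forall>\<^sub>F b in at_top. (1 - exp (- s * complex_of_real b)) / s
      = integral {0..b} (\<lambda>t. exp (- s * complex_of_real t))"
    using eventually_ge_at_top [of 0] by eventually_elim (metis int integral_unique)
  ultimately have "((\<lambda>b. integral {0..b} (\<lambda>t. exp (- s * complex_of_real t))) \<longlongrightarrow> 1 / s) at_top"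
    by (simp add: tendsto_cong)
  then have "((\<lambda>t. exp (- s * complex_of_real t)) has_integral 1 / s) {0..}"
    unfolding has_integral_Ici_iff using int by blast
  then show ?thesis
    by (rule has_integral_spike [of "{0}", rotated 2]) (auto simp: unit_step_def)
qed

section \<open>Ordinary and impulse parts together\<close>

text \<open>
  One \<open>has_integral\<close> statement carries both the convergence and the value of a transform, so that
  the integration rules apply to the pair directly.
\<close>
lemma has_laplace_iff:
  "laplace_converges f s \<and> laplace f s = w \<longleftrightarrow>
   ((\<lambda>t. of_real (ordinary_part f t) * exp (- s * of_real t)) has_integral
      w - poly (map_poly of_real (impulse_coeffs f)) s) {0..}"
proof -
  have "poly (map_poly of_real p) s = (\<Sum>k\<le>degree p. complex_of_real (coeff p k) * s ^ k)" for p
    by (simp add: poly_altdef coeff_map_poly degree_map_poly)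
  then show ?thesis
    unfolding laplace_converges_def laplace_def has_integral_iff by auto
qed

text \<open>
  The coefficient of \<open>\<delta>\<close> turns into a step in the ordinary part. Its transform is the term that is
  missing from the shifted impulse polynomial to make up the quotient by \<open>s\<close>.
\<close>
lemma laplace_first_integral:
  assumes s: "Re s > 0" and conv: "laplace_converges f s"
    and null: "\<And>t. t < 0 \<Longrightarrow> ordinary_part f t = 0"
  shows "laplace_converges (first_integral u0 f) s \<and> laplace (first_integral u0 f) s = laplace f s / s"
proof -
  define g where "g = ordinary_part f"
  define p where "p = impulse_coeffs f"
  define P where "P = poly (map_poly complex_of_real p) s"
  have s0: "s \<noteq> 0" using s by auto
  have g: "((\<lambda>t. of_real (g t) * exp (- s * of_real t)) has_integral laplace f s - P) {0..}"
    using has_laplace_iff [of f s "laplace f s"] conv by (simp add: g_def p_def P_def)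
  \<comment> \<open>Vanishing on the negative axis turns the integral from \<open>-\<infinity>\<close> into one from 0; for negative
    \<open>t\<close> both are 0.\<close>
  have "integral {..t} g = integral {0..t} g" for t
  proof -
    have "integral {..t} g = integral {..t} (\<lambda>x. if x \<in> {0..} then g x else 0)"
      by (intro integral_cong) (auto simp: g_def null)
    also have "\<dots> = integral ({0..} \<inter> {..t}) g"
      by (rule integral_restrict_Int)
    also have "{0..} \<inter> {..t} = {0..t}" by auto
    finally show ?thesis .
  qed
  then have first: "first_integral u0 f =
      Gen_Fun (\<lambda>t. integral {0..t} g + coeff p 0 * unit_step u0 t) (poly_shift 1 p)"
    by (simp add: first_integral_def g_def p_def)
  have "p = pCons (coeff p 0) (poly_shift 1 p)"
    by (simp add: poly_eq_iff coeff_poly_shift coeff_pCons split: nat.split)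
  then have "map_poly complex_of_real p
      = pCons (of_real (coeff p 0)) (map_poly of_real (poly_shift 1 p))"
    by (metis map_poly_pCons of_real_0)
  then have P: "P = of_real (coeff p 0) + s * poly (map_poly of_real (poly_shift 1 p)) s"
    by (simp add: P_def)
  have "((\<lambda>t. of_real (integral {0..t} g) * exp (- s * of_real t)
           + of_real (coeff p 0) * (of_real (unit_step u0 t) * exp (- s * of_real t)))
         has_integral (laplace f s - P) / s + of_real (coeff p 0) * (1 / s)) {0..}"
    by (intro has_integral_add has_integral_mult_right laplace_primitive [OF s g] laplace_unit_step s)
  moreover have "(laplace f s - P) / s + of_real (coeff p 0) * (1 / s)
      = laplace f s / s - poly (map_poly of_real (poly_shift 1 p)) s"
    using s0 by (simp add: P field_simps)
  ultimately show ?thesis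
    by (simp add: has_laplace_iff first distrib_right mult.assoc)
qed

lemma laplace_nfold_integral:
  assumes s: "Re s > 0" and conv: "laplace_converges f s"
    and null: "\<And>t. t < 0 \<Longrightarrow> ordinary_part f t = 0"
  shows "laplace_converges (nfold_integral u0 n f) s \<and>
    laplace (nfold_integral u0 n f) s = s powi (- int n) * laplace f s"
proof -
  have "laplace_converges (nfold_integral u0 n f) s \<and>
    laplace (nfold_integral u0 n f) s = laplace f s / s ^ n \<and>
    (\<forall>t<0. ordinary_part (nfold_integral u0 n f) t = 0)"
  proof (induction n)
    case 0
    then show ?case using conv null by (simp add: nfold_integral_def)
  next
    case (Suc n)
    define F where "F = nfold_integral u0 n f"
    have IH: "laplace_converges F s" "laplace F s = laplace f s / s ^ n"
        "\<And>t. t < 0 \<Longrightarrow> ordinary_part F t = 0"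
      using Suc by (auto simp: F_def)
    have "integral {..t} (ordinary_part F) = integral {..t} (\<lambda>x. 0)" if "t < 0" for t
      using IH(3) that by (intro integral_cong) auto
    then have "\<forall>t<0. ordinary_part (first_integral u0 F) t = 0"
      by (simp add: first_integral_def unit_step_def)
    with laplace_first_integral [OF s IH(1,3), of u0] show ?case
      by (simp add: F_def nfold_integral_def IH(2) [unfolded F_def nfold_integral_def] mult.commute)
  qed
  then show ?thesis
    by (simp add: power_int_minus divide_inverse mult.commute)
qed

text \<open>On \<open>[0,\<infinity>)\<close> the unit step differs from 1 at most at the origin, a null set.\<close>
lemma laplace_step_times:
  "laplace_converges (step_times u0 f) s \<longleftrightarrow> laplace_converges f s"
  "laplace (step_times u0 f) s = laplace f s"
proof -
  have "((\<lambda>t. of_real (ordinary_part (step_times u0 f) t) * exp (- s * of_real t)) has_integral w) {0..}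
    \<longleftrightarrow> ((\<lambda>t. of_real (ordinary_part f t) * exp (- s * of_real t)) has_integral w) {0..}" for w
    by (rule has_integral_spike_eq [of "{0}"]) (auto simp: step_times_def unit_step_def)
  then show "laplace_converges (step_times u0 f) s \<longleftrightarrow> laplace_converges f s"
    "laplace (step_times u0 f) s = laplace f s"
    by (simp_all add: laplace_converges_def laplace_def integrable_on_def integral_def step_times_def)
qed

theorem mainTheorem2:
  fixes f fc :: gen_fun and u0 :: real and s :: complex and n :: nat
  assumes "u0 \<in> {0..1}" and "Re s > 0"
  shows "(laplace_converges f s \<longrightarrow>
            laplace_converges (nfold_integral u0 n (step_times u0 f)) s \<and>
            laplace (nfold_integral u0 n (step_times u0 f)) s = s powi (- int n) * laplace f s) \<and>
         (causal u0 fc \<and> laplace_converges fc s \<longrightarrow>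
            laplace_converges (nfold_integral u0 n fc) s \<and>
            laplace (nfold_integral u0 n fc) s = s powi (- int n) * laplace fc s)"
proof (intro conjI impI; (elim conjE)?)
  assume "laplace_converges f s"
  then have "laplace_converges (step_times u0 f) s" by (simp only: laplace_step_times)
  moreover have "ordinary_part (step_times u0 f) t = 0" if "t < 0" for t
    using that by (simp add: step_times_def unit_step_def)
  ultimately have *: "laplace_converges (nfold_integral u0 n (step_times u0 f)) s \<and>
    laplace (nfold_integral u0 n (step_times u0 f)) s = s powi (- int n) * laplace (step_times u0 f) s"
    by (rule laplace_nfold_integral [OF assms(2)])
  show "laplace_converges (nfold_integral u0 n (step_times u0 f)) s"
    and "laplace (nfold_integral u0 n (step_times u0 f)) s = s powi (- int n) * laplace f s"
    using * by (simp_all only: laplace_step_times)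
next
  assume c: "causal u0 fc" and conv: "laplace_converges fc s"
  have "ordinary_part fc t = 0" if "t < 0" for t
    using c that by (simp add: causal_def)
  note * = laplace_nfold_integral [OF assms(2) conv this]
  show "laplace_converges (nfold_integral u0 n fc) s"
    and "laplace (nfold_integral u0 n fc) s = s powi (- int n) * laplace fc s"
    using * by blast+
qed

end
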